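(* Let $F_{n+1}$ be the free group with basis $\{a_0,a_1,\dots,a_n\}$ and let $F_n=\langle a_1,\dots,a_n\rangle$. For $w\in F_n$ let $R_w\in\mathrm{Aut}(F_{n+1})$ be the automorphism with $R_w(a_0)=a_0w$ and $R_w(a_i)=a_i$ for $i>0$. If $w\in F_n$ lies in a free factor of $F_n$ of rank $n-2$, then $R_w$ fixes a point whenever $\mathrm{Aut}(F_{n+1})$ acts by semisimple isometries on a complete $\mathrm{CAT}(0)$ space.
   Context: For an isometry $\gamma$ of a complete $\mathrm{CAT}(0)$ space $X$, put $\|\gamma\|=\inf\{d(x,\gamma.x)\mid x\in X\}$ and $\mathrm{Min}(\gamma)=\{x\in X\mid d(x,\gamma.x)=\|\gamma\|\}$. The isometry $\gamma$ is semisimple if $\mathrm{Min}(\gamma)\ne\emptyset$. An action is by semisimple isometries if every group element acts as a semisimple isometry. *)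

theory Defs
  imports "HOL-Analysis.Analysis" "HOL-Algebra.Generated_Groups" "HOL-Algebra.Group_Action"
begin

section \<open>Free groups\<close>

text \<open>A letter \<open>(x, True)\<close> stands for \<open>x\<close> and \<open>(x, False)\<close> for its inverse.\<close>

definition letter_val :: "('a, 'm) monoid_scheme \<Rightarrow> 'a \<times> bool \<Rightarrow> 'a" where
  "letter_val G l = (if snd l then fst l else inv\<^bsub>G\<^esub> (fst l))"

definition word_val :: "('a, 'm) monoid_scheme \<Rightarrow> ('a \<times> bool) list \<Rightarrow> 'a" where
  "word_val G ls = foldr (\<lambda>l g. letter_val G l \<otimes>\<^bsub>G\<^esub> g) ls \<one>\<^bsub>G\<^esub>"

definition reduced_word :: "('a \<times> bool) list \<Rightarrow> bool" where
  "reduced_word = successively (\<lambda>l l'. \<not> (fst l = fst l' \<and> snd l \<noteq> snd l'))"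

definition free_basis :: "('a, 'm) monoid_scheme \<Rightarrow> 'a set \<Rightarrow> bool" where
  "free_basis G B \<longleftrightarrow>
     group G \<and> B \<subseteq> carrier G \<and> generate G B = carrier G \<and>
     (\<forall>ls. ls \<noteq> [] \<and> fst ` set ls \<subseteq> B \<and> reduced_word ls \<longrightarrow> word_val G ls \<noteq> \<one>\<^bsub>G\<^esub>)"

abbreviation generated_group ::
    "('a, 'm) monoid_scheme \<Rightarrow> 'a set \<Rightarrow> ('a, 'm) monoid_scheme" where
  "generated_group G S \<equiv> G\<lparr>carrier := generate G S\<rparr>"

definition free_of_rank :: "('a, 'm) monoid_scheme \<Rightarrow> nat \<Rightarrow> bool" where
  "free_of_rank G r \<longleftrightarrow> (\<exists>B. free_basis G B \<and> finite B \<and> card B = r)"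

text \<open>A free factor of a free group is a subgroup generated by part of a basis.\<close>

definition free_factor :: "('a, 'm) monoid_scheme \<Rightarrow> 'a set \<Rightarrow> bool" where
  "free_factor G H \<longleftrightarrow> (\<exists>B C. free_basis G B \<and> C \<subseteq> B \<and> H = generate G C)"


section \<open>Complete CAT(0) spaces\<close>

definition geodesic_segment :: "'b set \<Rightarrow> ('b \<Rightarrow> 'b \<Rightarrow> real) \<Rightarrow> 'b \<Rightarrow> 'b \<Rightarrow> 'b set \<Rightarrow> bool" where
  "geodesic_segment X d x y S \<longleftrightarrow>
     (\<exists>c :: real \<Rightarrow> 'b. c ` {0..d x y} = S \<and> S \<subseteq> X \<and> c 0 = x \<and> c (d x y) = y \<and>
        (\<forall>s\<in>{0..d x y}. \<forall>t\<in>{0..d x y}. d (c s) (c t) = \<bar>s - t\<bar>))"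

text \<open>
  In the triangle inequality for CAT(0) spaces, two points on distinct sides of a geodesic triangle
  lie on sides with a common vertex, here called \<open>x\<close>; for two points on the same side the
  inequality is trivially an equality. The points \<open>x'\<close>, \<open>y'\<close>, \<open>z'\<close> are the
  vertices of a comparison triangle in the Euclidean plane, and \<open>p'\<close>, \<open>q'\<close> are
  the comparison points of \<open>p\<close>, \<open>q\<close>.
\<close>

definition cat0_space :: "'b set \<Rightarrow> ('b \<Rightarrow> 'b \<Rightarrow> real) \<Rightarrow> bool" where
  "cat0_space X d \<longleftrightarrow>
     Metric_space X d \<and>
     (\<forall>x\<in>X. \<forall>y\<in>X. \<exists>S. geodesic_segment X d x y S) \<and>
     (\<forall>x\<in>X. \<forall>y\<in>X. \<forall>z\<in>X. \<forall>S T. geodesic_segment X d x y S \<and> geodesic_segment X d x z T \<longrightarrow>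
        (\<forall>x' y' z' :: real^2.
           dist x' y' = d x y \<and> dist x' z' = d x z \<and> dist y' z' = d y z \<longrightarrow>
           (\<forall>p\<in>S. \<forall>q\<in>T. \<forall>p'\<in>closed_segment x' y'. \<forall>q'\<in>closed_segment x' z'.
              dist x' p' = d x p \<and> dist x' q' = d x q \<longrightarrow> d p q \<le> dist p' q')))"

definition complete_cat0_space :: "'b set \<Rightarrow> ('b \<Rightarrow> 'b \<Rightarrow> real) \<Rightarrow> bool" where
  "complete_cat0_space X d \<longleftrightarrow> cat0_space X d \<and> Metric_space.mcomplete X d"


section \<open>Semisimple isometries\<close>

definition isometry_of :: "'b set \<Rightarrow> ('b \<Rightarrow> 'b \<Rightarrow> real) \<Rightarrow> ('b \<Rightarrow> 'b) \<Rightarrow> bool" where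
  "isometry_of X d f \<longleftrightarrow> bij_betw f X X \<and> (\<forall>x\<in>X. \<forall>y\<in>X. d (f x) (f y) = d x y)"

definition translation_length :: "'b set \<Rightarrow> ('b \<Rightarrow> 'b \<Rightarrow> real) \<Rightarrow> ('b \<Rightarrow> 'b) \<Rightarrow> real" where
  "translation_length X d f = (INF x\<in>X. d x (f x))"

definition Min_set :: "'b set \<Rightarrow> ('b \<Rightarrow> 'b \<Rightarrow> real) \<Rightarrow> ('b \<Rightarrow> 'b) \<Rightarrow> 'b set" where
  "Min_set X d f = {x \<in> X. d x (f x) = translation_length X d f}"

definition semisimple_isometry :: "'b set \<Rightarrow> ('b \<Rightarrow> 'b \<Rightarrow> real) \<Rightarrow> ('b \<Rightarrow> 'b) \<Rightarrow> bool" where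
  "semisimple_isometry X d f \<longleftrightarrow> isometry_of X d f \<and> Min_set X d f \<noteq> {}"

definition acts_by_semisimple_isometries ::
    "('g, 'm) monoid_scheme \<Rightarrow> 'b set \<Rightarrow> ('b \<Rightarrow> 'b \<Rightarrow> real) \<Rightarrow> ('g \<Rightarrow> 'b \<Rightarrow> 'b) \<Rightarrow> bool" where
  "acts_by_semisimple_isometries G X d \<phi> \<longleftrightarrow>
     group_action G X \<phi> \<and> (\<forall>g\<in>carrier G. semisimple_isometry X d (\<phi> g))"

end

theory Submission
  imports Defs
begin

text \<open>
  Two commuting isometries with axes translate a common flat by vectors whose inner product is
  determined by translation lengths. For a fixed isometry \<open>g\<close> this inner product with \<open>g\<close> is a
  homomorphism from the centralizer of \<open>g\<close> to the reals, so it vanishes on commutators of elements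
  that commute with \<open>g\<close>. If such a commutator \<open>z\<close> has the same translation length as \<open>g\<close> and as
  \<open>g z\<close>, then Pythagoras makes this length 0, and the semisimple isometry \<open>g\<close> fixes a point
  (\<open>fixed_point_if_centralizer_commutator\<close>).

  The transvection \<open>R\<close> is such an element \<open>g\<close>. Since \<open>w\<close> lies in a free factor of rank \<open>n - 2\<close>, the
  free group has a basis that contains \<open>x = a 0\<close> and two further elements \<open>b\<close>, \<open>c\<close> such that \<open>w\<close>
  is a word in the other ones. Let \<open>z\<close>, \<open>s\<close> and \<open>t\<close> be the automorphisms \<open>c \<mapsto> c w\<close>,
  \<open>c \<mapsto> c b\<close> and \<open>b \<mapsto> b w\<close>. They commute with \<open>R\<close> because \<open>R\<close> only changes \<open>x\<close>, and \<open>z\<close> is a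
  commutator of \<open>s\<close> and \<open>t\<close>. The automorphism \<open>R z\<close> is \<open>x \<mapsto> x w\<close>, \<open>c \<mapsto> c w\<close>; it fixes \<open>c x^{-1}\<close>
  and its inverse \<open>x c^{-1}\<close>. With the former in place of \<open>c\<close> in the basis it looks like \<open>R\<close>, with
  the latter in place of \<open>x\<close> it looks like \<open>z\<close>, so the three are conjugate and have
  the same translation length (\<open>transvection_fixed_point\<close>).

  The inner product is handled without a splitting theorem. Comparing both diagonals of a
  geodesic quadrilateral with its sides shows that the squared translation length obeys the
  parallelogram law on commuting pairs (\<open>transl_parallelogram\<close>), and additivity of the polarized form
  on the whole centralizer (\<open>transl_form_mult\<close>) comes from estimating displacements of
  \<open>g\<^sup>m h\<close> at a point of the axis of \<open>g\<close> as \<open>m\<close> grows.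

  For the algebra, words in a basis give the universal property (\<open>free_basis_universal\<close>). It yields
  the automorphisms, and its homomorphisms to a group of order 2 show that a free group of rank \<open>n\<close>
  is not generated by \<open>n - 1\<close> elements, which is why the rank bound leaves room for \<open>b\<close> and \<open>c\<close>.
\<close>

section \<open>The Bruhat-Tits inequality\<close>

lemma comparison_triangle:
  fixes p q r :: real
  assumes "0 \<le> p" "0 \<le> q" "0 \<le> r" "p \<le> q + r" "q \<le> p + r" "r \<le> p + q"
  obtains x y z :: "real^2" where "dist x y = p" "dist x z = q" "dist y z = r"
proof (cases "p = 0")
  case True
  with assms have "q = r" by simp
  have "dist (0::real^2) 0 = p" "dist (0::real^2) (vector [q, 0]) = q"
    using True assms by (simp_all add: dist_norm norm_vec_def L2_set_def UNIV_2)
  then show ?thesis using that[of 0 0 "vector [q, 0]"] \<open>q = r\<close> by simp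
next
  case False
  define u where "u = (p\<^sup>2 + q\<^sup>2 - r\<^sup>2) / (2 * p)"
  define v where "v = sqrt (q\<^sup>2 - u\<^sup>2)"
  have "\<bar>p - q\<bar> \<le> r" using assms by auto
  then have "(p - q)\<^sup>2 \<le> r\<^sup>2" using assms by (simp add: abs_le_square_iff[symmetric])
  then have u1: "u \<le> q" using assms False by (simp add: u_def field_simps power2_eq_square)
  have "r\<^sup>2 \<le> (p + q)\<^sup>2" using assms by (intro power_mono) auto
  then have u2: "- q \<le> u" using assms False by (simp add: u_def field_simps power2_eq_square)
  from u1 u2 have "u\<^sup>2 \<le> q\<^sup>2" using assms by (simp add: abs_le_square_iff[symmetric] abs_le_iff)
  then have v2: "v\<^sup>2 = q\<^sup>2 - u\<^sup>2" by (simp add: v_def)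
  have up: "2 * p * u = p\<^sup>2 + q\<^sup>2 - r\<^sup>2" using False by (simp add: u_def)
  have 1: "dist (0::real^2) (vector [p, 0]) = p"
    using assms by (simp add: dist_norm norm_vec_def L2_set_def UNIV_2)
  have 2: "dist (0::real^2) (vector [u, v]) = q"
    using assms v2 by (simp add: dist_norm norm_vec_def L2_set_def UNIV_2)
  have "(p - u)\<^sup>2 + v\<^sup>2 = r\<^sup>2" using v2 up by (simp add: power2_eq_square algebra_simps)
  then have 3: "dist (vector [p, 0] :: real^2) (vector [u, v]) = r"
    using assms by (simp add: dist_norm norm_vec_def L2_set_def UNIV_2)
  show ?thesis using that[OF 1 2 3] .
qed

lemma dist_midpoint_sqr:
  fixes x y z :: "'v :: real_inner"
  shows "(dist (midpoint x y) z)\<^sup>2 = (dist x z)\<^sup>2 / 2 + (dist y z)\<^sup>2 / 2 - (dist x y)\<^sup>2 / 4"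
proof -
  define u v where "u = x - z" and "v = y - z"
  have "midpoint x y - z = (1/2) *\<^sub>R (u + v)"
    by (simp add: midpoint_def u_def v_def algebra_simps flip: scaleR_2)
  then have "(dist (midpoint x y) z)\<^sup>2 = (norm (u + v))\<^sup>2 / 4"
    by (simp add: dist_norm power_divide)
  moreover have "dist x y = norm (u - v)" by (simp add: dist_norm u_def v_def)
  moreover have "(norm (u + v))\<^sup>2 + (norm (u - v))\<^sup>2 = 2 * (norm u)\<^sup>2 + 2 * (norm v)\<^sup>2"
    by (simp add: power2_norm_eq_inner inner_commute algebra_simps)
  ultimately show ?thesis
    unfolding dist_norm[of x z] dist_norm[of y z] u_def[symmetric] v_def[symmetric]
    by simp
qed

text \<open>
  Comparing the segment from the midpoint of \<open>x\<close> and \<open>y\<close> to \<open>z\<close> with a median of a Euclidean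
  triangle gives the inequality of Bruhat and Tits. All later uses of nonpositive curvature go
  through it.
\<close>

lemma cat0_midpoint:
  assumes cat0: "cat0_space X d" and x: "x \<in> X" and y: "y \<in> X"
  shows "\<exists>m\<in>X. \<forall>z\<in>X. (d m z)\<^sup>2 \<le> (d x z)\<^sup>2 / 2 + (d y z)\<^sup>2 / 2 - (d x y)\<^sup>2 / 4"
proof -
  interpret Metric_space X d using cat0 by (simp add: cat0_space_def)
  obtain S where S: "geodesic_segment X d x y S"
    using cat0 x y unfolding cat0_space_def by blast
  then obtain c where c: "c ` {0..d x y} = S" "S \<subseteq> X" "c 0 = x" "c (d x y) = y"
    and iso: "\<forall>s\<in>{0..d x y}. \<forall>t\<in>{0..d x y}. d (c s) (c t) = \<bar>s - t\<bar>"
    unfolding geodesic_segment_def by blast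
  define m where "m = c (d x y / 2)"
  have mS: "m \<in> S" and mX: "m \<in> X" using c unfolding m_def by auto
  have xm: "d x m = d x y / 2" using iso c(3) unfolding m_def by fastforce
  have "(d m z)\<^sup>2 \<le> (d x z)\<^sup>2 / 2 + (d y z)\<^sup>2 / 2 - (d x y)\<^sup>2 / 4" if z: "z \<in> X" for z
  proof -
    obtain T where T: "geodesic_segment X d x z T"
      using cat0 x z unfolding cat0_space_def by blast
    then obtain c' where "c' ` {0..d x z} = T" "c' (d x z) = z"
      unfolding geodesic_segment_def by blast
    then have zT: "z \<in> T" 
      using imageI[of "d x z" "{0..d x z}" c'] nonneg[of x z] by simp
    have tri: "d x y \<le> d x z + d y z" "d x z \<le> d x y + d y z" "d y z \<le> d x y + d x z"
      using triangle'[OF x z y] triangle[OF x y z] triangle''[OF y x z] by (auto simp: commute)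
    obtain x' y' z' :: "real^2" where t: "dist x' y' = d x y" "dist x' z' = d x z" "dist y' z' = d y z"
      by (rule comparison_triangle[OF nonneg nonneg nonneg tri])
    have "dist x' (midpoint x' y') = d x m" using t xm by (simp add: dist_midpoint)
    from conjI[OF this t(2)] have "d m z \<le> dist (midpoint x' y') z'"
      by (rule cat0[unfolded cat0_space_def, THEN conjunct2, THEN conjunct2, rule_format,
          OF x y z conjI[OF S T] conjI[OF t(1) conjI[OF t(2,3)]] mS zT
            midpoint_in_closed_segment ends_in_segment(2)])
    then have "(d m z)\<^sup>2 \<le> (dist (midpoint x' y') z')\<^sup>2" by (simp add: power_mono)
    then show ?thesis by (simp add: dist_midpoint_sqr t)
  qed
  then show ?thesis using mX by blast
qed

text \<open>
  This discards the lower-order error terms from estimates along the powers \<open>g\<close>, \<open>g^2\<close>, \<open>g^4\<close>,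
  \<open>g^8\<close>, and so on.
\<close>

lemma nonpos_if_four_power_growth_le_two_power:
  fixes e A B :: real
  assumes "\<And>j::nat. (2 ^ j)\<^sup>2 * e \<le> A + B * 2 ^ j"
  shows "e \<le> 0"
proof (rule ccontr)
  assume "\<not> e \<le> 0"
  then have e: "e > 0" by simp
  obtain j :: nat where j: "(\<bar>A\<bar> + \<bar>B\<bar>) / e < 2 ^ j"
    using real_arch_pow[of 2] by auto
  let ?t = "2 ^ j :: real"
  have t: "1 \<le> ?t" by simp
  have "A + B * ?t \<le> \<bar>A\<bar> * ?t + \<bar>B\<bar> * ?t"
    by (intro add_mono mult_right_mono) (use t mult_left_mono[OF t, of "\<bar>A\<bar>"] in auto)
  also have "\<dots> = (\<bar>A\<bar> + \<bar>B\<bar>) * ?t" by (simp add: distrib_right)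
  also have "\<dots> < ?t * e * ?t"
    using j e t by (intro mult_strict_right_mono) (auto simp: pos_divide_less_eq)
  finally show False using assms[of j] by (simp add: power2_eq_square mult_ac)
qed

section \<open>Translation lengths of commuting semisimple isometries\<close>

locale semisimple_action = group_action G X \<phi> + Metric_space X d
  for G (structure) and X \<phi> and d +
  assumes cat0: "cat0_space X d"
    and semisimple: "g \<in> carrier G \<Longrightarrow> semisimple_isometry X d (\<phi> g)"
begin

sublocale group G
  using group_hom group_hom.axioms(1) by auto

lemma inv_commute:
  assumes "g \<in> carrier G" "h \<in> carrier G" "g \<otimes> h = h \<otimes> g"
  shows "inv g \<otimes> h = h \<otimes> inv g"
  using assms by (metis inv_closed inv_solve_left inv_solve_right m_assoc m_closed)

lemma commute_mult:
  assumes "g \<in> carrier G" "h \<in> carrier G" "k \<in> carrier G"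
    and "g \<otimes> h = h \<otimes> g" "g \<otimes> k = k \<otimes> g"
  shows "g \<otimes> (h \<otimes> k) = h \<otimes> k \<otimes> g"
  using assms by (metis m_assoc)

lemma act_closed [simp]: "g \<in> carrier G \<Longrightarrow> x \<in> X \<Longrightarrow> \<phi> g x \<in> X"
  by (simp add: element_image)

lemma act_dist [simp]:
  "g \<in> carrier G \<Longrightarrow> x \<in> X \<Longrightarrow> y \<in> X \<Longrightarrow> d (\<phi> g x) (\<phi> g y) = d x y"
  using semisimple by (simp add: semisimple_isometry_def isometry_of_def)

lemma act_mult [simp]:
  "g \<in> carrier G \<Longrightarrow> h \<in> carrier G \<Longrightarrow> x \<in> X \<Longrightarrow> \<phi> (g \<otimes> h) x = \<phi> g (\<phi> h x)"
  by (simp add: composition_rule)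

lemma act_one [simp]: "x \<in> X \<Longrightarrow> \<phi> \<one> x = x"
  by (simp flip: id_eq_one)

lemma act_act_inv [simp]: "g \<in> carrier G \<Longrightarrow> x \<in> X \<Longrightarrow> \<phi> g (\<phi> (inv g) x) = x"
  by (simp flip: act_mult)

lemma act_inv_act [simp]: "g \<in> carrier G \<Longrightarrow> x \<in> X \<Longrightarrow> \<phi> (inv g) (\<phi> g x) = x"
  by (simp add: orbit_sym_aux)

definition transl :: "'a \<Rightarrow> real"
  where "transl g = translation_length X d (\<phi> g)"

lemma transl_attained:
  assumes "g \<in> carrier G"
  obtains x where "x \<in> X" "d x (\<phi> g x) = transl g"
  using semisimple[OF assms] that
  unfolding semisimple_isometry_def Min_set_def transl_def by blast

lemma transl_le: "x \<in> X \<Longrightarrow> transl g \<le> d x (\<phi> g x)"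
  unfolding transl_def translation_length_def
  by (rule cINF_lower) (auto intro: bdd_belowI[of _ 0])

lemma transl_nonneg: "g \<in> carrier G \<Longrightarrow> 0 \<le> transl g"
  using transl_attained nonneg by metis

text \<open>
  If \<open>g h = h g'\<close>, then \<open>h\<close> carries a point of least displacement for \<open>g'\<close> to a point that \<open>g\<close>
  moves equally far.
\<close>

lemma transl_intertwined_le:
  assumes "g \<in> carrier G" "g' \<in> carrier G" "h \<in> carrier G" "g \<otimes> h = h \<otimes> g'"
  shows "transl g \<le> transl g'"
proof -
  obtain x where x: "x \<in> X" "d x (\<phi> g' x) = transl g'" using transl_attained assms(2) by blast
  have "transl g \<le> d (\<phi> h x) (\<phi> (g \<otimes> h) x)" using transl_le[of "\<phi> h x" g] assms(1-3) x by simp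
  also have "\<dots> = transl g'" unfolding assms(4) using assms(1-3) x by simp
  finally show ?thesis .
qed

lemma transl_eq_if_conjugate:
  assumes "g \<in> carrier G" "g' \<in> carrier G" "h \<in> carrier G" "g \<otimes> h = h \<otimes> g'"
  shows "transl g = transl g'"
proof (rule antisym)
  have "g' \<otimes> inv h = inv h \<otimes> (h \<otimes> g') \<otimes> inv h"
    using assms(1-3) by (simp flip: m_assoc)
  also have "\<dots> = inv h \<otimes> g"
    using assms(1-3) by (simp flip: assms(4) add: m_assoc)
  finally show "transl g' \<le> transl g" using assms by (intro transl_intertwined_le[of _ _ "inv h"]) auto
qed (use assms transl_intertwined_le in blast)

lemma transl_inv:
  assumes "g \<in> carrier G"
  shows "transl (inv g) = transl g"
proof -
  have "transl (inv h) \<le> transl h" if "h \<in> carrier G" for h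
  proof -
    obtain x where "x \<in> X" "d x (\<phi> h x) = transl h" using transl_attained \<open>h \<in> carrier G\<close> by blast
    then show ?thesis
      using transl_le[of "\<phi> h x" "inv h"] that by (simp add: commute)
  qed
  from this[of g] this[of "inv g"] show ?thesis using assms by force
qed

lemma midpoint_obtain:
  assumes "x \<in> X" "y \<in> X"
  obtains m where "m \<in> X"
    "\<And>z. z \<in> X \<Longrightarrow> (d m z)\<^sup>2 \<le> (d x z)\<^sup>2 / 2 + (d y z)\<^sup>2 / 2 - (d x y)\<^sup>2 / 4"
  using cat0_midpoint[OF cat0 assms] by blast

text \<open>
  Apply the Bruhat-Tits inequality to the midpoint of one diagonal and both ends of the other. In the
  Euclidean plane the difference of the two sides is the squared norm of \<open>p - q + r - s\<close>.
\<close>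

lemma quadrilateral:
  assumes "p \<in> X" "q \<in> X" "r \<in> X" "s \<in> X"
  shows "(d p r)\<^sup>2 + (d q s)\<^sup>2 \<le> (d p q)\<^sup>2 + (d q r)\<^sup>2 + (d r s)\<^sup>2 + (d s p)\<^sup>2"
proof -
  obtain m where m: "m \<in> X"
    and CN: "\<And>z. z \<in> X \<Longrightarrow> (d m z)\<^sup>2 \<le> (d p z)\<^sup>2 / 2 + (d r z)\<^sup>2 / 2 - (d p r)\<^sup>2 / 4"
    using midpoint_obtain assms by blast
  have "d q s \<le> d m q + d m s" using triangle[of q m s] m assms by (simp add: commute)
  then have "(d q s)\<^sup>2 \<le> (d m q + d m s)\<^sup>2" by (simp add: power_mono)
  also have "\<dots> \<le> 2 * (d m q)\<^sup>2 + 2 * (d m s)\<^sup>2"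
    using sum_squares_bound[of "d m q" "d m s"] by (simp add: power2_sum)
  finally show ?thesis using CN[of q] CN[of s] assms
    by (simp add: commute[of r q] commute[of s p])
qed

text \<open>
  The segment from the midpoint of \<open>x\<close> and \<open>g x\<close> to its image joins midpoints of two sides of the
  triangle \<open>x\<close>, \<open>g x\<close>, \<open>g (g x)\<close>, so its length is at most half of the third side. Thus translation
  lengths of iterated squares grow linearly; this makes the infimum of displacements a substitute for the
  asymptotic displacement rate.
\<close>

lemma transl_square_ge:
  assumes g: "g \<in> carrier G"
  shows "2 * transl g \<le> transl (g \<otimes> g)"
proof -
  obtain x where x: "x \<in> X" "d x (\<phi> (g \<otimes> g) x) = transl (g \<otimes> g)" using transl_attained g by blast
  let ?y = "\<phi> g x" and ?z = "\<phi> g (\<phi> g x)"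
  obtain m where m: "m \<in> X"
    and CN: "\<And>v. v \<in> X \<Longrightarrow> (d m v)\<^sup>2 \<le> (d x v)\<^sup>2 / 2 + (d ?y v)\<^sup>2 / 2 - (d x ?y)\<^sup>2 / 4"
    using midpoint_obtain[of x ?y] x g by auto
  let ?m = "\<phi> g m"
  have a: "(d m ?m)\<^sup>2 \<le> (d x ?m)\<^sup>2 / 2 + (d ?y ?m)\<^sup>2 / 2 - (d x ?y)\<^sup>2 / 4"
    using CN[of ?m] m g by simp
  have CN': "(d ?m v)\<^sup>2 \<le> (d ?y v)\<^sup>2 / 2 + (d ?z v)\<^sup>2 / 2 - (d x ?y)\<^sup>2 / 4" if "v \<in> X" for v
    using CN[of "\<phi> (inv g) v"] act_dist[of g _ "\<phi> (inv g) v"] g m x(1) that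
    by simp
  have b: "(d x ?m)\<^sup>2 \<le> (d x ?y)\<^sup>2 / 2 + (d x ?z)\<^sup>2 / 2 - (d x ?y)\<^sup>2 / 4"
    using CN'[of x] x by (simp add: commute)
  have c: "(d ?y ?m)\<^sup>2 \<le> (d x ?y)\<^sup>2 / 4"
    using CN'[of ?y] x g by (simp add: commute)
  from a b c have "(d m ?m)\<^sup>2 \<le> (d x ?z)\<^sup>2 / 4" by simp
  then have "(2 * d m ?m)\<^sup>2 \<le> (d x ?z)\<^sup>2" by (simp add: power_mult_distrib)
  then have "2 * d m ?m \<le> d x ?z" by (rule power2_le_imp_le) simp
  moreover have "transl g \<le> d m ?m" using transl_le m by blast
  ultimately show ?thesis using x g by simp
qed

lemma transl_two_power_ge:
  assumes "g \<in> carrier G"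
  shows "2 ^ j * transl g \<le> transl (g [^] (2 ^ j :: nat))"
proof (induction j)
  case 0
  then show ?case using assms by simp
next
  case (Suc j)
  have "2 * transl (g [^] (2 ^ j :: nat)) \<le> transl (g [^] (2 ^ j :: nat) \<otimes> g [^] (2 ^ j :: nat))"
    using transl_square_ge assms by simp
  moreover have "g [^] (2 ^ j :: nat) \<otimes> g [^] (2 ^ j :: nat) = g [^] (2 ^ Suc j :: nat)"
    using assms by (simp add: nat_pow_mult mult_2)
  ultimately show ?case using Suc.IH by simp
qed

lemma dist_pow_le:
  assumes g: "g \<in> carrier G" and x: "x \<in> X"
  shows "d x (\<phi> (g [^] (k::nat)) x) \<le> k * d x (\<phi> g x)"
proof (induction k)
  case 0
  then show ?case using x by simp
next
  case (Suc k)
  have "d x (\<phi> (g [^] Suc k) x) \<le> d x (\<phi> (g [^] k) x) + d (\<phi> (g [^] k) x) (\<phi> (g [^] Suc k) x)"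
    using g x by (intro triangle) auto
  also have "d (\<phi> (g [^] k) x) (\<phi> (g [^] Suc k) x) = d x (\<phi> g x)"
    using g x by simp
  finally show ?case using Suc.IH by (simp add: algebra_simps)
qed

text \<open>
  Let \<open>x\<close> be a point of least displacement for \<open>g\<close> and \<open>k = 2^j\<close>. The points \<open>x\<close>, \<open>g^k x\<close>, \<open>g^k h^k x\<close>, \<open>h^k x\<close> span a quadrilateral
  whose diagonals are displacements by \<open>(g h)^k\<close> and \<open>(g^{-1} h)^k\<close>. Division by \<open>k^2\<close> turns
  the quadrilateral inequality into the claim, up to an error that tends to 0.
\<close>

lemma transl_parallelogram_le:
  assumes g: "g \<in> carrier G" and h: "h \<in> carrier G" and gh: "g \<otimes> h = h \<otimes> g"
  shows "(transl (g \<otimes> h))\<^sup>2 + (transl (inv g \<otimes> h))\<^sup>2 \<le> 2 * (transl g)\<^sup>2 + 2 * (transl h)\<^sup>2"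
proof -
  obtain x where x: "x \<in> X" "d x (\<phi> g x) = transl g" using transl_attained g by blast
  obtain y where y: "y \<in> X" "d y (\<phi> h y) = transl h" using transl_attained h by blast
  have igh: "inv g \<otimes> h = h \<otimes> inv g" using inv_commute[OF g h gh] .
  let ?e = "(transl (g \<otimes> h))\<^sup>2 + (transl (inv g \<otimes> h))\<^sup>2 - 2 * (transl g)\<^sup>2 - 2 * (transl h)\<^sup>2"
  have "?e \<le> 0"
  proof (rule nonpos_if_four_power_growth_le_two_power)
    fix j :: nat
    define k :: nat where "k = 2 ^ j"
    have k: "2 ^ j = real k" by (simp add: k_def)
    let ?a = "g [^] k" and ?b = "h [^] k"
    have ab: "?a \<otimes> ?b = ?b \<otimes> ?a" using g h gh by (metis nat_pow_comm pow_mult_distrib)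
    have "real k * transl (g \<otimes> h) \<le> d x (\<phi> (?a \<otimes> ?b) x)"
      using transl_two_power_ge[of "g \<otimes> h" j] transl_le[of x "?a \<otimes> ?b"] g h x(1)
      by (simp add: k pow_mult_distrib[OF gh] flip: k_def)
    then have 1: "(real k * transl (g \<otimes> h))\<^sup>2 \<le> (d x (\<phi> (?a \<otimes> ?b) x))\<^sup>2"
      using g h transl_nonneg by (intro power_mono) auto
    have "real k * transl (inv g \<otimes> h) \<le> d x (\<phi> (inv ?a \<otimes> ?b) x)"
      using transl_two_power_ge[of "inv g \<otimes> h" j] transl_le[of x "inv ?a \<otimes> ?b"] g h x(1)
      by (simp add: k pow_mult_distrib[OF igh] nat_pow_inv flip: k_def)
    also have "\<dots> = d (\<phi> ?a x) (\<phi> ?b x)"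
      using act_dist[of ?a x "\<phi> (inv ?a \<otimes> ?b) x"] g h x by (simp flip: act_mult m_assoc)
    finally have 2: "(real k * transl (inv g \<otimes> h))\<^sup>2 \<le> (d (\<phi> ?a x) (\<phi> ?b x))\<^sup>2"
      using g h transl_nonneg by (intro power_mono) auto
    have "(d x (\<phi> (?a \<otimes> ?b) x))\<^sup>2 + (d (\<phi> ?a x) (\<phi> ?b x))\<^sup>2
        \<le> (d x (\<phi> ?a x))\<^sup>2 + (d (\<phi> ?a x) (\<phi> (?a \<otimes> ?b) x))\<^sup>2
          + (d (\<phi> (?a \<otimes> ?b) x) (\<phi> ?b x))\<^sup>2 + (d (\<phi> ?b x) x)\<^sup>2"
      using g h x by (intro quadrilateral) auto
    also have "d (\<phi> ?a x) (\<phi> (?a \<otimes> ?b) x) = d x (\<phi> ?b x)" using g h x by simp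
    also have "d (\<phi> (?a \<otimes> ?b) x) (\<phi> ?b x) = d x (\<phi> ?a x)"
      unfolding ab using g h x by (simp add: commute)
    finally have 3: "(d x (\<phi> (?a \<otimes> ?b) x))\<^sup>2 + (d (\<phi> ?a x) (\<phi> ?b x))\<^sup>2
        \<le> 2 * (d x (\<phi> ?a x))\<^sup>2 + 2 * (d x (\<phi> ?b x))\<^sup>2" by (simp add: commute)
    have "d x (\<phi> ?a x) \<le> real k * transl g" using dist_pow_le[OF g x(1)] x by simp
    then have 4: "(d x (\<phi> ?a x))\<^sup>2 \<le> (real k * transl g)\<^sup>2" by (intro power_mono) auto
    \<comment> \<open>Least displacement for \<open>h\<close> is attained at \<open>y\<close>, maybe not at \<open>x\<close>; the detour through \<open>y\<close> costs a bounded amount.\<close>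
    have "d x (\<phi> ?b x) \<le> d x y + d y (\<phi> ?b x)" using x y h by (intro triangle) auto
    also have "d y (\<phi> ?b x) \<le> d y (\<phi> ?b y) + d (\<phi> ?b y) (\<phi> ?b x)"
      using x y h by (intro triangle) auto
    also have "d (\<phi> ?b y) (\<phi> ?b x) = d x y" using x y h by (simp add: commute)
    also have "d y (\<phi> ?b y) \<le> real k * transl h" using dist_pow_le[OF h y(1)] y by simp
    finally have "d x (\<phi> ?b x) \<le> 2 * d x y + real k * transl h" by simp
    then have 5: "(d x (\<phi> ?b x))\<^sup>2 \<le> (2 * d x y + real k * transl h)\<^sup>2" by (intro power_mono) auto
    show "(2 ^ j)\<^sup>2 * ?e \<le> 8 * (d x y)\<^sup>2 + (8 * d x y * transl h) * 2 ^ j"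
      using 1 2 3 4 5 unfolding k by (simp add: power2_eq_square algebra_simps)
  qed
  then show ?thesis by simp
qed

text \<open>
  The reverse inequality is the previous one for the pair \<open>g h\<close>, \<open>g^{-1} h\<close>, whose product and quotient
  are the squares \<open>h^2\<close> and \<open>g^{-2}\<close>.
\<close>

lemma transl_parallelogram:
  assumes g: "g \<in> carrier G" and h: "h \<in> carrier G" and gh: "g \<otimes> h = h \<otimes> g"
  shows "(transl (g \<otimes> h))\<^sup>2 + (transl (inv g \<otimes> h))\<^sup>2 = 2 * (transl g)\<^sup>2 + 2 * (transl h)\<^sup>2"
proof (rule antisym)
  have igh: "inv g \<otimes> h = h \<otimes> inv g" using inv_commute[OF g h gh] .
  have sq: "4 * (transl u)\<^sup>2 \<le> (transl (u \<otimes> u))\<^sup>2" if "u \<in> carrier G" for u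
    using power_mono[OF transl_square_ge[OF that], of 2] transl_nonneg[OF that]
    by (simp add: power_mult_distrib)
  let ?u = "g \<otimes> h" and ?v = "inv g \<otimes> h"
  have 1: "?u \<otimes> ?v = h \<otimes> h"
  proof -
    have "?u \<otimes> ?v = h \<otimes> (g \<otimes> inv g) \<otimes> h"
      unfolding gh by (simp only: m_assoc m_closed inv_closed g h)
    then show ?thesis using g h by simp
  qed
  have 2: "?v \<otimes> ?u = h \<otimes> h"
  proof -
    have "?v \<otimes> ?u = h \<otimes> (inv g \<otimes> g) \<otimes> h"
      unfolding igh by (simp only: m_assoc m_closed inv_closed g h)
    then show ?thesis using g h by simp
  qed
  have 3: "inv ?u \<otimes> ?v = inv (g \<otimes> g)"
  proof -
    have "inv ?u \<otimes> ?v = inv g \<otimes> inv h \<otimes> (h \<otimes> inv g)" 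
      using g h by (simp add: gh igh inv_mult_group)
    also have "\<dots> = inv g \<otimes> (inv h \<otimes> h) \<otimes> inv g"
      by (simp only: m_assoc m_closed inv_closed g h)
    finally show ?thesis using g h by (simp add: inv_mult_group)
  qed
  have "(transl (?u \<otimes> ?v))\<^sup>2 + (transl (inv ?u \<otimes> ?v))\<^sup>2 \<le> 2 * (transl ?u)\<^sup>2 + 2 * (transl ?v)\<^sup>2"
    using g h 1 2 by (intro transl_parallelogram_le) auto
  then show "2 * (transl g)\<^sup>2 + 2 * (transl h)\<^sup>2 \<le> (transl (g \<otimes> h))\<^sup>2 + (transl (inv g \<otimes> h))\<^sup>2"
    unfolding 1 3 using sq[OF g] sq[OF h] g h by (simp add: transl_inv)
qed (use transl_parallelogram_le assms in blast)

text \<open>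
  For commuting \<open>g\<close> and \<open>h\<close> this is twice the inner product of their translation vectors.
\<close>

definition transl_form :: "'a \<Rightarrow> 'a \<Rightarrow> real"
  where "transl_form g h = (transl (g \<otimes> h))\<^sup>2 - (transl g)\<^sup>2 - (transl h)\<^sup>2"

lemma transl_form_inv:
  assumes "g \<in> carrier G" "h \<in> carrier G" "g \<otimes> h = h \<otimes> g"
  shows "transl_form (inv g) h = - transl_form g h" and "transl_form g (inv h) = - transl_form g h"
proof -
  show *: "transl_form (inv g) h = - transl_form g h"
    using transl_parallelogram[OF assms] assms by (simp add: transl_form_def transl_inv)
  have "g \<otimes> inv h = inv (inv g \<otimes> h)"
    using assms(1,2) inv_commute[OF assms] by (simp add: inv_mult_group)
  then have "transl (g \<otimes> inv h) = transl (inv g \<otimes> h)" using assms by (simp add: transl_inv)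
  then show "transl_form g (inv h) = - transl_form g h" using * assms by (simp add: transl_form_def transl_inv)
qed

text \<open>
  The parallelogram law for \<open>g\<close> and \<open>g^{m+1} h\<close> is a linear recurrence in \<open>m\<close> with constant second
  difference \<open>2 * (transl g)^2\<close>, so the squared length is a quadratic polynomial in \<open>m\<close>.
\<close>

lemma transl_sqr_pow_mult:
  assumes g: "g \<in> carrier G" and h: "h \<in> carrier G" and gh: "g \<otimes> h = h \<otimes> g"
  shows "(transl (g [^] (m::nat) \<otimes> h))\<^sup>2 = (real m)\<^sup>2 * (transl g)\<^sup>2 + real m * transl_form g h + (transl h)\<^sup>2"
proof (induction m rule: induct_nat_012)
  case 0
  then show ?case using h by simp
next
  case 1
  then show ?case using g by (simp add: transl_form_def)
next
  case (ge2 m)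
  let ?u = "g [^] Suc m \<otimes> h"
  have gp: "g \<otimes> g [^] k = g [^] Suc k" for k :: nat using g by (simp only: nat_pow_Suc2)
  have 1: "g \<otimes> ?u = g [^] Suc (Suc m) \<otimes> h"
    using g h gp[of "Suc m"] by (simp only: m_closed nat_pow_closed flip: m_assoc)
  have 2: "inv g \<otimes> ?u = g [^] m \<otimes> h"
    using g h unfolding gp[symmetric] by (simp flip: m_assoc)
  have "g \<otimes> ?u = ?u \<otimes> g"
    using g h gh gp[of "Suc m"] by (intro commute_mult) auto
  then have "(transl (g \<otimes> ?u))\<^sup>2 + (transl (inv g \<otimes> ?u))\<^sup>2 = 2 * (transl g)\<^sup>2 + 2 * (transl ?u)\<^sup>2"
    using g h by (intro transl_parallelogram) auto
  then show ?case unfolding 1 2 ge2 by (simp add: power2_eq_square algebra_simps)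
qed

text \<open>
  At a point of least displacement for \<open>g\<close>, the displacement by \<open>g^m h\<close> exceeds its minimum, given by
  \<open>transl_sqr_pow_mult\<close>, only by an amount that is bounded after squaring: in the quadrilateral \<open>x\<close>, \<open>g^m x\<close>,
  \<open>g^m h x\<close>, \<open>h x\<close> the other diagonal is a displacement by \<open>g^{-m} h\<close>, and \<open>transl_sqr_pow_mult\<close> for
  \<open>g^{-1}\<close> bounds it from below.
\<close>

lemma dist_pow_mult_sqr_le:
  assumes g: "g \<in> carrier G" and h: "h \<in> carrier G" and gh: "g \<otimes> h = h \<otimes> g"
    and x: "x \<in> X" "d x (\<phi> g x) = transl g"
  shows "(d x (\<phi> (g [^] (m::nat) \<otimes> h) x))\<^sup>2
      \<le> (real m)\<^sup>2 * (transl g)\<^sup>2 + real m * transl_form g h + 2 * (d x (\<phi> h x))\<^sup>2"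
proof -
  let ?a = "g [^] m"
  have ah: "?a \<otimes> h = h \<otimes> ?a"
    using g h gh by (rule group_commutes_pow[rotated])
  have "(d x (\<phi> (?a \<otimes> h) x))\<^sup>2 + (d (\<phi> ?a x) (\<phi> h x))\<^sup>2
      \<le> (d x (\<phi> ?a x))\<^sup>2 + (d (\<phi> ?a x) (\<phi> (?a \<otimes> h) x))\<^sup>2
        + (d (\<phi> (?a \<otimes> h) x) (\<phi> h x))\<^sup>2 + (d (\<phi> h x) x)\<^sup>2"
    using g h x by (intro quadrilateral) auto
  also have "d (\<phi> ?a x) (\<phi> (?a \<otimes> h) x) = d x (\<phi> h x)" using g h x by simp
  also have "d (\<phi> (?a \<otimes> h) x) (\<phi> h x) = d x (\<phi> ?a x)"
    unfolding ah using g h x by (simp add: commute)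
  also have "d (\<phi> ?a x) (\<phi> h x) = d x (\<phi> (inv ?a \<otimes> h) x)"
    using act_dist[of ?a x "\<phi> (inv ?a) (\<phi> h x)"] g h x(1) by simp
  finally have 1: "(d x (\<phi> (?a \<otimes> h) x))\<^sup>2 + (d x (\<phi> (inv ?a \<otimes> h) x))\<^sup>2
      \<le> 2 * (d x (\<phi> ?a x))\<^sup>2 + 2 * (d x (\<phi> h x))\<^sup>2" by (simp add: commute)
  have "d x (\<phi> ?a x) \<le> real m * transl g" using dist_pow_le[OF g x(1)] x by simp
  then have 2: "(d x (\<phi> ?a x))\<^sup>2 \<le> (real m)\<^sup>2 * (transl g)\<^sup>2"
    by (simp flip: power_mult_distrib add: power_mono)
  have "inv ?a \<otimes> h = (inv g) [^] m \<otimes> h" using g by (simp add: nat_pow_inv)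
  then have "(transl (inv ?a \<otimes> h))\<^sup>2
      = (real m)\<^sup>2 * (transl g)\<^sup>2 - real m * transl_form g h + (transl h)\<^sup>2"
    using transl_sqr_pow_mult[OF inv_closed[OF g] h inv_commute[OF g h gh], of m]
    by (simp add: transl_form_inv(1)[OF g h gh] transl_inv[OF g])
  moreover have "(transl (inv ?a \<otimes> h))\<^sup>2 \<le> (d x (\<phi> (inv ?a \<otimes> h) x))\<^sup>2"
    using transl_nonneg g h by (intro power_mono transl_le[OF x(1)]) auto
  ultimately show ?thesis using 1 2 by (smt (verit) zero_le_power2)
qed

text \<open>
  Here \<open>h\<close> and \<open>k\<close> commute with \<open>g\<close> and possibly not with each other. The product of \<open>g^m h\<close> and
  \<open>g^m k\<close> is \<open>g^{2m} h k\<close>, so the squared translation length of the latter is at most twice the sum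
  of the squared displacements of a point by the two factors. At a point of least displacement for \<open>g\<close> the terms quadratic in
  \<open>m\<close> on both sides agree, and the terms linear in \<open>m\<close> give the claim.
\<close>

lemma transl_form_mult_le:
  assumes g: "g \<in> carrier G" and h: "h \<in> carrier G" and k: "k \<in> carrier G"
    and gh: "g \<otimes> h = h \<otimes> g" and gk: "g \<otimes> k = k \<otimes> g"
  shows "transl_form g (h \<otimes> k) \<le> transl_form g h + transl_form g k"
proof -
  obtain x where x: "x \<in> X" "d x (\<phi> g x) = transl g" using transl_attained g by blast
  let ?e = "transl_form g (h \<otimes> k) - transl_form g h - transl_form g k"
  let ?A = "4 * (d x (\<phi> h x))\<^sup>2 + 4 * (d x (\<phi> k x))\<^sup>2"
  have "2 * real m * ?e \<le> ?A" for m :: nat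
  proof -
    let ?a = "g [^] m"
    have ah: "?a \<otimes> h = h \<otimes> ?a"
      using g h gh by (rule group_commutes_pow[rotated])
    have "g [^] (2 * m) \<otimes> (h \<otimes> k) = ?a \<otimes> (?a \<otimes> h) \<otimes> k"
      using g h k by (simp add: mult_2 m_assoc flip: nat_pow_mult)
    also have "\<dots> = ?a \<otimes> (h \<otimes> ?a) \<otimes> k" by (simp only: ah)
    also have "\<dots> = (?a \<otimes> h) \<otimes> (?a \<otimes> k)" using g h k by (simp add: m_assoc)
    finally have split: "g [^] (2 * m) \<otimes> (h \<otimes> k) = (?a \<otimes> h) \<otimes> (?a \<otimes> k)" .
    have "transl (g [^] (2 * m) \<otimes> (h \<otimes> k)) \<le> d x (\<phi> (?a \<otimes> h \<otimes> (?a \<otimes> k)) x)"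
      unfolding split using x by (intro transl_le)
    also have "\<dots> \<le> d x (\<phi> (?a \<otimes> h) x) + d (\<phi> (?a \<otimes> h) x) (\<phi> (?a \<otimes> h \<otimes> (?a \<otimes> k)) x)"
      using g h k x by (intro triangle) auto
    also have "d (\<phi> (?a \<otimes> h) x) (\<phi> (?a \<otimes> h \<otimes> (?a \<otimes> k)) x) = d x (\<phi> (?a \<otimes> k) x)"
      using g h k x by simp
    finally have "(transl (g [^] (2 * m) \<otimes> (h \<otimes> k)))\<^sup>2
        \<le> (d x (\<phi> (?a \<otimes> h) x) + d x (\<phi> (?a \<otimes> k) x))\<^sup>2"
      using transl_nonneg g h k by (intro power_mono) auto
    also have "\<dots> \<le> 2 * (d x (\<phi> (?a \<otimes> h) x))\<^sup>2 + 2 * (d x (\<phi> (?a \<otimes> k) x))\<^sup>2"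
      using sum_squares_bound[of "d x (\<phi> (?a \<otimes> h) x)" "d x (\<phi> (?a \<otimes> k) x)"]
      by (simp add: power2_sum)
    finally have "(transl (g [^] (2 * m) \<otimes> (h \<otimes> k)))\<^sup>2
        \<le> 2 * (d x (\<phi> (?a \<otimes> h) x))\<^sup>2 + 2 * (d x (\<phi> (?a \<otimes> k) x))\<^sup>2" .
    moreover have "(transl (g [^] (2 * m) \<otimes> (h \<otimes> k)))\<^sup>2
        = 4 * ((real m)\<^sup>2 * (transl g)\<^sup>2) + 2 * (real m * transl_form g (h \<otimes> k)) + (transl (h \<otimes> k))\<^sup>2"
      using transl_sqr_pow_mult[of g "h \<otimes> k" "2 * m"] g h k commute_mult[OF g h k gh gk]
      by (simp add: power_mult_distrib)
    ultimately have "2 * (real m * transl_form g (h \<otimes> k))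
        \<le> 2 * (real m * transl_form g h) + 2 * (real m * transl_form g k) + ?A"
      using dist_pow_mult_sqr_le[OF g h gh x, of m] dist_pow_mult_sqr_le[OF g k gk x, of m]
        zero_le_power2[of "transl (h \<otimes> k)"]
      by linarith
    then show ?thesis by (simp add: algebra_simps)
  qed
  then have le: "real m * (2 * ?e) \<le> ?A" for m :: nat by (simp only: mult_ac)
  have "\<not> 2 * ?e > 0" using reals_Archimedean3[of "2 * ?e"] le by (meson not_less)
  then show ?thesis by simp
qed

lemma transl_form_mult:
  assumes g: "g \<in> carrier G" and h: "h \<in> carrier G" and k: "k \<in> carrier G"
    and gh: "g \<otimes> h = h \<otimes> g" and gk: "g \<otimes> k = k \<otimes> g"
  shows "transl_form g (h \<otimes> k) = transl_form g h + transl_form g k"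
proof (rule antisym)
  have "transl_form g h = transl_form g (h \<otimes> k \<otimes> inv k)" using h k by (simp add: m_assoc)
  also have "\<dots> \<le> transl_form g (h \<otimes> k) + transl_form g (inv k)"
    using g h k commute_mult[OF g h k gh gk] inv_commute[OF k g gk[symmetric]]
    by (intro transl_form_mult_le) auto
  finally show "transl_form g h + transl_form g k \<le> transl_form g (h \<otimes> k)" using transl_form_inv(2)[OF g k gk] by simp
qed (use transl_form_mult_le assms in blast)

text \<open>
  By additivity \<open>transl_form g z = 0\<close>, whereas the assumptions on the lengths make it
  \<open>- (transl g)^2\<close>.
\<close>

theorem fixed_point_if_centralizer_commutator:
  assumes carr: "g \<in> carrier G" "z \<in> carrier G" "s \<in> carrier G" "t \<in> carrier G"
    and comm: "g \<otimes> z = z \<otimes> g" "g \<otimes> s = s \<otimes> g" "g \<otimes> t = t \<otimes> g"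
    and z: "t \<otimes> s = s \<otimes> (z \<otimes> t)"
    and len: "transl z = transl g" "transl (g \<otimes> z) = transl g"
  shows "\<exists>x\<in>X. \<phi> g x = x"
proof -
  have "transl_form g t + transl_form g s = transl_form g (s \<otimes> (z \<otimes> t))"
    using transl_form_mult carr comm by (simp flip: z)
  also have "\<dots> = transl_form g s + (transl_form g z + transl_form g t)"
    using carr comm commute_mult by (simp add: transl_form_mult)
  finally have "transl_form g z = 0" by simp
  then have "transl g = 0" using len by (simp add: transl_form_def)
  then show ?thesis using transl_attained[OF carr(1)] carr by (metis act_closed zero)
qed

end

section \<open>Free groups: universal property and rank\<close>

lemma letter_val_closed:
  "group G \<Longrightarrow> fst l \<in> carrier G \<Longrightarrow> letter_val G l \<in> carrier G"
  by (simp add: letter_val_def)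

lemma word_val_simps [simp]:
  "word_val G [] = \<one>\<^bsub>G\<^esub>" "word_val G (l # ls) = letter_val G l \<otimes>\<^bsub>G\<^esub> word_val G ls"
  by (simp_all add: word_val_def)

lemma word_val_closed:
  assumes "group G" "fst ` set ls \<subseteq> carrier G"
  shows "word_val G ls \<in> carrier G"
proof -
  interpret group G by fact
  show ?thesis using assms(2) by (induction ls) (auto simp: letter_val_closed)
qed

lemma word_val_append:
  assumes "group G" "fst ` set us \<subseteq> carrier G" "fst ` set vs \<subseteq> carrier G"
  shows "word_val G (us @ vs) = word_val G us \<otimes>\<^bsub>G\<^esub> word_val G vs"
proof -
  interpret group G by fact
  show ?thesis using assms(2,3)
    by (induction us) (auto simp: letter_val_closed word_val_closed m_assoc)
qed

lemma word_val_cancel: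
  assumes "group G" "fst ` set us \<subseteq> carrier G" "fst ` set vs \<subseteq> carrier G" "p \<in> carrier G" "i \<noteq> j"
  shows "word_val G (us @ [(p, i), (p, j)] @ vs) = word_val G (us @ vs)"
proof -
  interpret group G by fact
  have "letter_val G (p, i) \<otimes>\<^bsub>G\<^esub> (letter_val G (p, j) \<otimes>\<^bsub>G\<^esub> word_val G vs) = word_val G vs"
    using assms by (cases i) (auto simp: letter_val_def word_val_closed simp flip: m_assoc)
  then show ?thesis using assms by (simp add: word_val_append)
qed

definition inverse_word :: "('a \<times> bool) list \<Rightarrow> ('a \<times> bool) list"
  where "inverse_word ls = rev (map (\<lambda>(x, i). (x, \<not> i)) ls)"

lemma fst_inverse_word [simp]: "fst ` set (inverse_word ls) = fst ` set ls"
  by (force simp: inverse_word_def)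

lemma word_val_inverse_word:
  assumes "group G" "fst ` set ls \<subseteq> carrier G"
  shows "word_val G (inverse_word ls) = inv\<^bsub>G\<^esub> (word_val G ls)"
proof -
  interpret group G by fact
  show ?thesis using assms(2)
  proof (induction ls)
    case Nil
    then show ?case by (simp add: inverse_word_def)
  next
    case (Cons l ls)
    obtain p i where l: "l = (p, i)" by force
    have sub: "fst ` set (inverse_word ls) \<subseteq> carrier G" using Cons.prems by simp
    have "word_val G (inverse_word (l # ls)) = word_val G (inverse_word ls @ [(p, \<not> i)])"
      by (simp add: inverse_word_def l)
    also have "\<dots> = inv\<^bsub>G\<^esub> (word_val G ls) \<otimes>\<^bsub>G\<^esub> letter_val G (p, \<not> i)"
      using sub Cons l by (subst word_val_append) (auto simp: letter_val_closed is_group)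
    also have "letter_val G (p, \<not> i) = inv\<^bsub>G\<^esub> (letter_val G l)"
      using Cons.prems l by (auto simp: letter_val_def)
    finally show ?case using Cons.prems
      by (simp add: inv_mult_group letter_val_closed word_val_closed is_group)
  qed
qed

lemma generate_word:
  assumes "group G" "B \<subseteq> carrier G" "x \<in> generate G B"
  shows "\<exists>ls. fst ` set ls \<subseteq> B \<and> word_val G ls = x"
  using assms(3)
proof induction
  case one
  then show ?case by (intro exI[of _ "[]"]) simp
next
  case (incl h)
  then show ?case using assms
    by (intro exI[of _ "[(h, True)]"]) (auto simp: letter_val_def group.is_monoid)
next
  case (inv h)
  then show ?case using assms
    by (intro exI[of _ "[(h, False)]"]) (auto simp: letter_val_def group.is_monoid)
next
  case (eng g h)
  then obtain us vs where "fst ` set us \<subseteq> B" "word_val G us = g"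
    "fst ` set vs \<subseteq> B" "word_val G vs = h" by blast
  then show ?case using assms
    by (intro exI[of _ "us @ vs"]) (auto simp: word_val_append image_Un)
qed

lemma not_reduced_word_split:
  assumes "\<not> reduced_word ls"
  shows "\<exists>us p i j vs. ls = us @ [(p, i), (p, j)] @ vs \<and> i \<noteq> j"
  using assms unfolding reduced_word_def
proof (induction ls rule: induct_list012)
  case (3 l l' ls)
  show ?case
  proof (cases "fst l = fst l' \<and> snd l \<noteq> snd l'")
    case True
    then have "l # l' # ls = [] @ [(fst l, snd l), (fst l, snd l')] @ ls"
      by (simp add: prod_eq_iff)
    with True show ?thesis by blast
  next
    case False
    then obtain us p i j vs where "l' # ls = us @ [(p, i), (p, j)] @ vs" "i \<noteq> j"
      using 3 by auto
    then show ?thesis by (intro exI[of _ "l # us"]) auto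
  qed
qed auto

text \<open>
  A nonempty word with trivial value is not reduced. Deleting a cancelling pair of letters changes neither
  its value nor that of its image, so induction on the length applies.
\<close>

lemma trivial_word_trivial_image:
  assumes B: "free_basis G B" and K: "group K" and f: "f \<in> B \<rightarrow> carrier K"
    and "fst ` set ls \<subseteq> B" "word_val G ls = \<one>\<^bsub>G\<^esub>"
  shows "word_val K (map (apfst f) ls) = \<one>\<^bsub>K\<^esub>"
  using assms(4,5)
proof (induction "length ls" arbitrary: ls rule: less_induct)
  case less
  have G: "group G" and sub: "B \<subseteq> carrier G" using B by (auto simp: free_basis_def)
  show ?case
  proof (cases "ls = []")
    case False
    then have "\<not> reduced_word ls" using B less.prems unfolding free_basis_def by blast
    then obtain us p i j vs where ls: "ls = us @ [(p, i), (p, j)] @ vs" and ij: "i \<noteq> j"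
      using not_reduced_word_split by blast
    have l: "fst ` set us \<subseteq> B" "fst ` set vs \<subseteq> B" "p \<in> B" using less.prems(1) ls by auto
    have "word_val G ls = word_val G (us @ vs)"
      unfolding ls using l sub ij by (intro word_val_cancel[OF G]) auto
    then have "word_val G (us @ vs) = \<one>\<^bsub>G\<^esub>" using less.prems(2) by simp
    then have "word_val K (map (apfst f) (us @ vs)) = \<one>\<^bsub>K\<^esub>"
      using less.hyps[of "us @ vs"] l ls by (auto simp: image_Un)
    moreover have "fst ` set (map (apfst f) us) \<subseteq> carrier K" "fst ` set (map (apfst f) vs) \<subseteq> carrier K"
      using l f by (auto simp: Pi_iff image_subset_iff)
    ultimately show ?thesis
      using word_val_cancel[OF K, of "map (apfst f) us" "map (apfst f) vs" "f p" i j] f l(3) ij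
      by (simp add: ls Pi_iff)
  qed simp
qed

text \<open>
  The value of a word determines the value of its image: if two words have the same value, the
  product of one with the inverse of the other is a word with trivial value.
\<close>

theorem free_basis_universal:
  assumes B: "free_basis G B" and K: "group K" and f: "f \<in> B \<rightarrow> carrier K"
  shows "\<exists>h\<in>hom G K. \<forall>b\<in>B. h b = f b"
proof -
  have G: "group G" and sub: "B \<subseteq> carrier G" and gen: "generate G B = carrier G"
    using B by (auto simp: free_basis_def)
  interpret G: group G by fact
  interpret K: group K by fact
  define img where "img ls = word_val K (map (apfst f) ls)" for ls
  define h where "h x = img (SOME ls. fst ` set ls \<subseteq> B \<and> word_val G ls = x)" for x
  have mapK: "fst ` set (map (apfst f) ls) \<subseteq> carrier K" if "fst ` set ls \<subseteq> B" for ls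
    using that f by (auto simp: Pi_iff image_subset_iff)
  have inverse_map: "inverse_word (map (apfst f) ls) = map (apfst f) (inverse_word ls)" for ls
    by (auto simp: inverse_word_def rev_map)
  have img_eq: "img us = img vs"
    if l: "fst ` set us \<subseteq> B" "fst ` set vs \<subseteq> B" "word_val G us = word_val G vs" for us vs
  proof -
    have lc: "fst ` set us \<subseteq> carrier G" "fst ` set vs \<subseteq> carrier G" using l sub by auto
    have "word_val G (us @ inverse_word vs) = \<one>\<^bsub>G\<^esub>"
      using lc l by (simp add: word_val_append word_val_inverse_word word_val_closed G)
    then have "word_val K (map (apfst f) (us @ inverse_word vs)) = \<one>\<^bsub>K\<^esub>"
      using l by (intro trivial_word_trivial_image[OF B K f]) (auto simp: image_Un)
    moreover have "word_val K (map (apfst f) (us @ inverse_word vs)) = img us \<otimes>\<^bsub>K\<^esub> inv\<^bsub>K\<^esub> (img vs)"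
      using word_val_append[OF K mapK mapK, of us "inverse_word vs"]
        word_val_inverse_word[OF K mapK, of vs] l
      by (simp add: img_def inverse_map del: set_map)
    moreover have "img us \<in> carrier K" "img vs \<in> carrier K"
      unfolding img_def by (rule word_val_closed[OF K mapK[OF l(1)]], rule word_val_closed[OF K mapK[OF l(2)]])
    ultimately show ?thesis using K.inv_solve_right[of "\<one>\<^bsub>K\<^esub>" "img us" "img vs"] by auto
  qed
  have h_word: "h (word_val G ls) = img ls" if "fst ` set ls \<subseteq> B" for ls
  proof -
    have "fst ` set ls \<subseteq> B \<and> word_val G ls = word_val G ls" using that by simp
    then have "fst ` set (SOME us. fst ` set us \<subseteq> B \<and> word_val G us = word_val G ls) \<subseteq> B
        \<and> word_val G (SOME us. fst ` set us \<subseteq> B \<and> word_val G us = word_val G ls) = word_val G ls"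
      by (rule someI)
    then show ?thesis unfolding h_def using img_eq that by blast
  qed
  have "h \<in> hom G K"
  proof (rule homI)
    fix x assume "x \<in> carrier G"
    then obtain us where us: "fst ` set us \<subseteq> B" "word_val G us = x"
      using generate_word[OF G sub] gen by blast
    show "h x \<in> carrier K"
      using h_word[OF us(1)] us word_val_closed[OF K mapK[OF us(1)]] by (simp add: img_def)
    fix y assume "y \<in> carrier G"
    then obtain vs where vs: "fst ` set vs \<subseteq> B" "word_val G vs = y"
      using generate_word[OF G sub] gen by blast
    have "word_val G (us @ vs) = x \<otimes>\<^bsub>G\<^esub> y" using us vs sub by (subst word_val_append) (auto simp: G)
    moreover have "h (word_val G (us @ vs)) = img (us @ vs)"
      using us vs by (intro h_word) (auto simp: image_Un)
    moreover have "img (us @ vs) = img us \<otimes>\<^bsub>K\<^esub> img vs"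
      using mapK us vs unfolding img_def map_append by (subst word_val_append) (simp_all add: K)
    ultimately show "h (x \<otimes>\<^bsub>G\<^esub> y) = h x \<otimes>\<^bsub>K\<^esub> h y" using h_word us vs by metis
  qed
  moreover have "h b = f b" if "b \<in> B" for b
  proof -
    have "b = word_val G [(b, True)]" using that sub by (auto simp: letter_val_def)
    then have "h b = img [(b, True)]" using h_word[of "[(b, True)]"] that by simp
    then show ?thesis using f that by (auto simp: img_def letter_val_def Pi_iff)
  qed
  ultimately show ?thesis by blast
qed

lemma hom_eq_on_generate:
  assumes "group G" "group K" "h \<in> hom G K" "h' \<in> hom G K" "S \<subseteq> carrier G"
    and "\<And>s. s \<in> S \<Longrightarrow> h s = h' s" and "x \<in> generate G S"
  shows "h x = h' x"
proof -
  interpret h: group_hom G K h using assms by (simp add: group_hom_def group_hom_axioms_def)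
  interpret h': group_hom G K h' using assms by (simp add: group_hom_def group_hom_axioms_def)
  have "h x = h' x \<and> x \<in> carrier G" using assms(7)
    by induction (use assms(5,6) in \<open>auto simp: subset_iff\<close>)
  then show ?thesis ..
qed

text \<open>
  A group of order 2 whose elements are truth values, so that homomorphisms into it are predicates.
\<close>

definition parity_group :: "bool monoid"
  where "parity_group = \<lparr>carrier = UNIV, mult = (\<noteq>), one = False\<rparr>"

lemma group_parity_group: "group parity_group"
  by (rule groupI) (auto simp: parity_group_def)

text \<open>
  Every subset of \<open>B\<close> is the support on \<open>B\<close> of a homomorphism to the group of order 2, and such a
  homomorphism is determined by its support on the generating set \<open>S\<close>. Hence \<open>B\<close> has at most as many
  subsets as \<open>S\<close>.
\<close>

lemma card_free_basis_le:
  assumes B: "free_basis G B" and "finite S" "S \<subseteq> carrier G" "generate G S = carrier G"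
  shows "card B \<le> card S"
proof (cases "finite B")
  case True
  have G: "group G" using B by (simp add: free_basis_def)
  have "\<forall>A. \<exists>h\<in>hom G parity_group. \<forall>b\<in>B. h b = (b \<in> A)"
    using free_basis_universal[OF B group_parity_group] by (simp add: parity_group_def)
  then obtain \<psi> where \<psi>: "\<And>A. \<psi> A \<in> hom G parity_group" "\<And>A b. b \<in> B \<Longrightarrow> \<psi> A b = (b \<in> A)"
    by metis
  have "inj_on (\<lambda>A. {s \<in> S. \<psi> A s}) (Pow B)"
  proof (rule inj_onI)
    fix A A' assume A: "A \<in> Pow B" "A' \<in> Pow B" "{s \<in> S. \<psi> A s} = {s \<in> S. \<psi> A' s}"
    have "\<psi> A b = \<psi> A' b" if "b \<in> B" for b
      using hom_eq_on_generate[OF G group_parity_group \<psi>(1) \<psi>(1), of S A A' b] A(3) assms that B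
      by (auto simp: free_basis_def)
    then show "A = A'" using \<psi>(2) A by auto
  qed
  then have "card (Pow B) \<le> card (Pow S)"
    using assms by (intro card_inj_on_le[of "\<lambda>A. {s \<in> S. \<psi> A s}"]) auto
  then show ?thesis using True assms by (simp add: card_Pow)
qed simp

text \<open>
  Some homomorphism to the group of order 2 is nontrivial on \<open>b\<close> and trivial on the other basis elements.
\<close>

lemma free_basis_notin_generate:
  assumes B: "free_basis G B" and b: "b \<in> B"
  shows "b \<notin> generate G (B - {b})"
proof
  assume gen: "b \<in> generate G (B - {b})"
  have G: "group G" and sub: "B \<subseteq> carrier G" using B by (auto simp: free_basis_def)
  obtain h where h: "h \<in> hom G parity_group" "\<forall>y\<in>B. h y = (y = b)"
    using free_basis_universal[OF B group_parity_group, of "\<lambda>y. y = b"]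
    by (auto simp: parity_group_def)
  have triv: "(\<lambda>_. False) \<in> hom G parity_group" by (auto simp: hom_def parity_group_def)
  have "h b = False"
    by (rule hom_eq_on_generate[OF G group_parity_group h(1) triv _ _ gen]) (use h sub in auto)
  then show False using h b by simp
qed

lemma word_val_subgroup:
  assumes "group G" "subgroup H G" "fst ` set ls \<subseteq> H"
  shows "word_val (G\<lparr>carrier := H\<rparr>) ls = word_val G ls"
  using assms(3)
  by (induction ls)
    (auto simp: letter_val_def group.m_inv_consistent[OF assms(1,2)])

lemma free_basis_subset:
  assumes B: "free_basis G B" and "C \<subseteq> B"
  shows "free_basis (generated_group G C) C"
proof -
  interpret group G using B by (simp add: free_basis_def)
  have sub: "C \<subseteq> carrier G" using assms by (auto simp: free_basis_def)
  have H: "subgroup (generate G C) G" using generate_is_subgroup[OF sub] .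
  have CH: "C \<subseteq> generate G C" by (auto intro: generate.incl)
  have "word_val (generated_group G C) ls \<noteq> \<one>\<^bsub>G\<^esub>"
    if "ls \<noteq> []" "fst ` set ls \<subseteq> C" "reduced_word ls" for ls
  proof -
    have "fst ` set ls \<subseteq> generate G C" using that(2) CH by (rule subset_trans)
    then have "word_val (generated_group G C) ls = word_val G ls"
      by (rule word_val_subgroup[OF is_group H])
    then show ?thesis using that assms unfolding free_basis_def by (metis subset_trans)
  qed
  then show ?thesis
    using CH H subgroup_imp_group[OF H] generate_consistent[OF CH H]
    by (auto simp: free_basis_def)
qed

text \<open>
  If \<open>B\<close> had at most one element \<open>e\<close> outside \<open>C\<close>, then \<open>insert e D\<close> would generate the
  group with fewer elements than the basis \<open>A\<close> has.
\<close>

lemma two_basis_elements_outside_factor: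
  assumes N: "free_basis G A" and B: "free_basis G B" and C: "C \<subseteq> B"
    and D: "finite D" "D \<subseteq> carrier G" "generate G D = generate G C" "card D + 2 \<le> card A"
  shows "\<exists>b\<in>B - C. \<exists>c\<in>B - C. b \<noteq> c"
proof (rule ccontr)
  assume contr: "\<not> ?thesis"
  interpret group G using B by (simp add: free_basis_def)
  have sub: "B \<subseteq> carrier G" "generate G B = carrier G" using B by (auto simp: free_basis_def)
  obtain e where e: "e \<in> carrier G" "B \<subseteq> insert e C"
  proof (cases "B \<subseteq> C")
    case True
    \<comment> \<open>No element of \<open>B\<close> lies outside \<open>C\<close>, so any \<open>e\<close> will do.\<close>
    then show thesis using that[of "\<one>\<^bsub>G\<^esub>"] by auto
  next
    case False
    then obtain e where "e \<in> B - C" by blast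
    moreover from this have "B \<subseteq> insert e C" using contr by auto
    ultimately show thesis using that[of e] sub by auto
  qed
  have gens: "insert e D \<subseteq> carrier G" using e D by auto
  have "C \<subseteq> generate G (insert e D)"
    using D(3) mono_generate[of D "insert e D"] generate.incl[of _ C G] by blast
  then have "generate G B \<subseteq> generate G (insert e D)"
    using e(2) by (intro generate_subgroup_incl generate_is_subgroup[OF gens])
      (auto intro: generate.incl)
  then have "generate G (insert e D) = carrier G" using sub generate_incl[OF gens] by auto
  then have "card A \<le> card (insert e D)" using card_free_basis_le[OF N] gens D(1) by simp
  also have "\<dots> \<le> Suc (card D)" using D(1) by (simp add: card_insert_if)
  finally show False using D(4) by simp
qed

section \<open>Transvections and their fixed points\<close>

text \<open>
  Extension of maps to endomorphisms is the property of a basis from which automorphisms are built,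
  and it passes to a new basis without a study of reduced words.
\<close>

definition universal_basis :: "('a, 'm) monoid_scheme \<Rightarrow> 'a set \<Rightarrow> bool"
  where "universal_basis G E \<longleftrightarrow>
    group G \<and> E \<subseteq> carrier G \<and> generate G E = carrier G \<and>
    (\<forall>f\<in>E \<rightarrow> carrier G. \<exists>h\<in>hom G G. \<forall>e\<in>E. h e = f e)"

text \<open>
  A basis of the subgroup generated by \<open>A\<close> can replace \<open>A\<close> in the basis \<open>insert x A\<close>. Extend the
  prescribed values on \<open>B\<close> to a homomorphism \<open>k\<close> on that subgroup, read off the values of \<open>k\<close> on \<open>A\<close>, and extend
  these together with the value at \<open>x\<close>.
\<close>

lemma universal_basis_insert:
  assumes basis: "free_basis F (insert x A)" and x: "x \<notin> A"
    and B: "free_basis (generated_group F A) B"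
  shows "universal_basis F (insert x B)" and "x \<notin> B"
proof -
  let ?N = "generate F A"
  have F: "group F" and sub: "insert x A \<subseteq> carrier F" and gen: "generate F (insert x A) = carrier F"
    using basis by (auto simp: free_basis_def)
  interpret group F by fact
  have N: "subgroup ?N F" using generate_is_subgroup sub by simp
  have BN: "B \<subseteq> ?N" and genB: "generate (generated_group F A) B = ?N"
    using B by (auto simp: free_basis_def)
  have AB: "?N = generate F B" using generate_consistent[OF BN N] genB by simp
  have NF: "?N \<subseteq> carrier F" using N subgroup.subset by blast
  have sub': "insert x B \<subseteq> carrier F" using BN NF sub by auto
  have "A \<subseteq> generate F (insert x B)"
    using AB mono_generate[of B "insert x B"] generate.incl[of _ A F] by auto
  then have "generate F (insert x A) \<subseteq> generate F (insert x B)"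
    by (intro generate_subgroup_incl generate_is_subgroup sub') (auto intro: generate.incl)
  then have gen': "generate F (insert x B) = carrier F"
    using gen generate_incl[OF sub'] by auto
  have "\<exists>h\<in>hom F F. \<forall>e\<in>insert x B. h e = f e" if f: "f \<in> insert x B \<rightarrow> carrier F" for f
  proof -
    obtain k where k: "k \<in> hom (generated_group F A) F" "\<forall>e\<in>B. k e = f e"
      using free_basis_universal[OF B F, of f] f by auto
    have kA: "k y \<in> carrier F" if "y \<in> A" for y
      using k(1) that generate.incl[OF that, of F] by (auto simp: hom_def Pi_iff)
    obtain h where h: "h \<in> hom F F" "\<forall>y\<in>insert x A. h y = (if y = x then f x else k y)"
      using free_basis_universal[OF basis F, of "\<lambda>y. if y = x then f x else k y"] f kA by auto
    have hN: "h \<in> hom (generated_group F A) F"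
      using h(1) NF by (auto simp: hom_def Pi_iff subset_iff)
    have "h e = k e" if "e \<in> ?N" for e
      by (rule hom_eq_on_generate[OF subgroup_imp_group[OF N] F hN k(1), of A])
        (use that h(2) x generate_consistent[OF _ N, of A] in \<open>auto intro: generate.incl\<close>)
    then show ?thesis using h k(2) BN by (intro bexI[of _ h]) auto
  qed
  then show "universal_basis F (insert x B)"
    using F sub' gen' by (auto simp: universal_basis_def)
  show "x \<notin> B" using free_basis_notin_generate[OF basis, of x] x BN by auto
qed

lemma auto_eq_on_basis:
  assumes "universal_basis F E" "f \<in> auto F" "g \<in> auto F" and eq: "\<And>e. e \<in> E \<Longrightarrow> f e = g e"
  shows "f = g"
proof (rule extensionalityI)
  show "f \<in> extensional (carrier F)" "g \<in> extensional (carrier F)"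
    using assms by (auto simp: auto_def Bij_def)
  show "f y = g y" if "y \<in> carrier F" for y
    by (rule hom_eq_on_generate[of F F f g E]) (use assms that in \<open>auto simp: universal_basis_def auto_def\<close>)
qed

text \<open>
  Since \<open>u\<close> does not involve \<open>e\<close>, the endomorphisms that send \<open>e\<close> to \<open>e u\<close> and to \<open>e u^{-1}\<close> and
  fix the other basis elements also fix \<open>u\<close>, so they are mutually inverse.
\<close>

lemma transvection_exists:
  assumes E: "universal_basis F E" and e: "e \<in> E" and u: "u \<in> generate F (E - {e})"
  obtains \<tau> where "\<tau> \<in> auto F" "\<tau> e = e \<otimes>\<^bsub>F\<^esub> u" "\<And>y. y \<in> generate F (E - {e}) \<Longrightarrow> \<tau> y = y"
proof -
  have F: "group F" and sub: "E \<subseteq> carrier F" and gen: "generate F E = carrier F"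
    using E by (auto simp: universal_basis_def)
  have ext: "\<exists>h\<in>hom F F. \<forall>y\<in>E. h y = f y" if "f \<in> E \<rightarrow> carrier F" for f
    using E that by (simp add: universal_basis_def)
  interpret group F by fact
  have sub': "E - {e} \<subseteq> carrier F" and eF: "e \<in> carrier F" using sub e by auto
  have id: "(\<lambda>y. y) \<in> hom F F" by (auto simp: hom_def)
  have ex: "\<exists>h. h \<in> hom F F \<and> h e = e \<otimes>\<^bsub>F\<^esub> v \<and> (\<forall>y\<in>generate F (E - {e}). h y = y)"
    if v: "v \<in> generate F (E - {e})" for v
  proof -
    have vF: "v \<in> carrier F" using generate_in_carrier[OF sub' v] .
    have "(\<lambda>y. if y = e then e \<otimes>\<^bsub>F\<^esub> v else y) \<in> E \<rightarrow> carrier F" using sub eF vF by auto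
    from ext[OF this] obtain h
      where h: "h \<in> hom F F" "\<forall>y\<in>E. h y = (if y = e then e \<otimes>\<^bsub>F\<^esub> v else y)" by blast
    have "h y = y" if "y \<in> generate F (E - {e})" for y
      by (rule hom_eq_on_generate[OF F F h(1) id sub' _ that]) (use h(2) in auto)
    then show ?thesis using h e by auto
  qed
  have iu: "inv\<^bsub>F\<^esub> u \<in> generate F (E - {e})" using generate_m_inv_closed[OF sub' u] .
  obtain h where h: "h \<in> hom F F" "h e = e \<otimes>\<^bsub>F\<^esub> u" "\<forall>y\<in>generate F (E - {e}). h y = y"
    using ex[OF u] by blast
  obtain k where k: "k \<in> hom F F" "k e = e \<otimes>\<^bsub>F\<^esub> inv\<^bsub>F\<^esub> u" "\<forall>y\<in>generate F (E - {e}). k y = y"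
    using ex[OF iu] by blast
  have uF: "u \<in> carrier F" using generate_in_carrier[OF sub' u] .
  have inverse: "h' (k' y) = y"
    if h': "h' \<in> hom F F" "h' e = e \<otimes>\<^bsub>F\<^esub> v" "\<forall>y\<in>generate F (E - {e}). h' y = y"
      and k': "k' \<in> hom F F" "k' e = e \<otimes>\<^bsub>F\<^esub> inv\<^bsub>F\<^esub> v" "\<forall>y\<in>generate F (E - {e}). k' y = y"
      and v: "v \<in> carrier F" "inv\<^bsub>F\<^esub> v \<in> generate F (E - {e})" and y: "y \<in> carrier F" for h' k' v y
  proof -
    have "(h' \<circ> k') y = y"
    proof (rule hom_eq_on_generate[OF F F _ id sub])
      show "h' \<circ> k' \<in> hom F F" using Group.hom_compose[OF k'(1) h'(1)] .
      show "y \<in> generate F E" using y gen by simp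
      fix s assume s: "s \<in> E"
      show "(h' \<circ> k') s = s"
      proof (cases "s = e")
        case True
        have "h' (e \<otimes>\<^bsub>F\<^esub> inv\<^bsub>F\<^esub> v) = h' e \<otimes>\<^bsub>F\<^esub> h' (inv\<^bsub>F\<^esub> v)"
          using hom_mult[OF h'(1)] eF v by simp
        then show ?thesis using True h' k' v eF by (simp add: m_assoc)
      next
        case False
        then have "s \<in> generate F (E - {e})" using s by (auto intro: generate.incl)
        then show ?thesis using h'(3) k'(3) by simp
      qed
    qed
    then show ?thesis by simp
  qed
  have closed: "h y \<in> carrier F" "k y \<in> carrier F" if "y \<in> carrier F" for y
    using h(1) k(1) that by (auto simp: hom_def)
  have "bij_betw h (carrier F) (carrier F)"
    using inverse[OF h k uF iu] inverse[OF k(1) _ k(3) h(1) _ h(3), of "inv\<^bsub>F\<^esub> u"] h(2) k(2) u uF closed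
    by (intro bij_betw_byWitness[where f' = k]) auto
  then have "restrict h (carrier F) \<in> auto F"
    using h(1) by (auto simp: auto_def Bij_def hom_def bij_betw_restrict_eq Pi_iff)
  then show thesis
    using h eF generate_incl[OF sub'] by (intro that[of "restrict h (carrier F)"]) auto
qed

text \<open>
  The choice of the automorphisms \<open>z\<close>, \<open>s\<close>, \<open>t\<close> is explained at the beginning. The base changes \<open>u\<close>
  (\<open>c \<mapsto> c x^{-1}\<close>) and \<open>v\<close> (\<open>x \<mapsto> x c^{-1}\<close>) conjugate \<open>R z\<close> to \<open>R\<close> and to \<open>z\<close>.
\<close>

theorem transvection_fixed_point:
  assumes E: "universal_basis F E"
    and xbc: "x \<in> E" "b \<in> E" "c \<in> E" "x \<noteq> b" "x \<noteq> c" "b \<noteq> c"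
    and w: "w \<in> generate F (E - {x, b, c})"
    and R: "R \<in> auto F" "R x = x \<otimes>\<^bsub>F\<^esub> w" "\<And>e. e \<in> E \<Longrightarrow> e \<noteq> x \<Longrightarrow> R e = e"
    and act: "semisimple_action (AutoGroup F) X \<phi> d"
  shows "\<exists>p\<in>X. \<phi> R p = p"
proof -
  have F: "group F" and sub: "E \<subseteq> carrier F" using E by (auto simp: universal_basis_def)
  interpret F: group F by fact
  interpret A: semisimple_action "AutoGroup F" X \<phi> d by fact
  let ?S = "\<lambda>e. generate F (E - {e})"
  have incl: "y \<in> ?S e" if "y \<in> E" "y \<noteq> e" for y e using that by (auto intro: generate.incl)
  have wS: "w \<in> ?S e" if "e \<in> {x, b, c}" for e
    using F.mono_generate[of "E - {x, b, c}" "E - {e}"] w that by auto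
  have subS: "E - {e} \<subseteq> carrier F" for e using sub by auto
  have carr: "x \<in> carrier F" "b \<in> carrier F" "c \<in> carrier F" "w \<in> carrier F"
    using sub xbc F.generate_in_carrier[OF subS wS] by auto
  have RS: "R y = y" if "y \<in> ?S x" for y
  proof (rule hom_eq_on_generate[OF F F _ _ subS _ that])
    show "R \<in> hom F F" "(\<lambda>y. y) \<in> hom F F" using R by (auto simp: auto_def hom_def)
  qed (use R in auto)
  obtain z where z: "z \<in> auto F" "z c = c \<otimes>\<^bsub>F\<^esub> w" "\<And>y. y \<in> ?S c \<Longrightarrow> z y = y"
    using transvection_exists[OF E xbc(3) wS] by blast
  obtain s where s: "s \<in> auto F" "s c = c \<otimes>\<^bsub>F\<^esub> b" "\<And>y. y \<in> ?S c \<Longrightarrow> s y = y"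
    using transvection_exists[OF E xbc(3) incl[OF xbc(2,6)]] by blast
  obtain t where t: "t \<in> auto F" "t b = b \<otimes>\<^bsub>F\<^esub> w" "\<And>y. y \<in> ?S b \<Longrightarrow> t y = y"
    using transvection_exists[OF E xbc(2) wS] by blast
  obtain u where u: "u \<in> auto F" "u c = c \<otimes>\<^bsub>F\<^esub> inv\<^bsub>F\<^esub> x" "\<And>y. y \<in> ?S c \<Longrightarrow> u y = y"
    using transvection_exists[OF E xbc(3) F.generate_m_inv_closed[OF subS incl[OF xbc(1,5)]]] by blast
  obtain v where v: "v \<in> auto F" "v x = x \<otimes>\<^bsub>F\<^esub> inv\<^bsub>F\<^esub> c" "\<And>y. y \<in> ?S x \<Longrightarrow> v y = y"
    using transvection_exists[OF E xbc(1) F.generate_m_inv_closed[OF subS incl[OF xbc(3)]]] xbc(5)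
    by metis
  have carrier: "carrier (AutoGroup F) = auto F" by (simp add: AutoGroup_def)
  have mult: "(f \<otimes>\<^bsub>AutoGroup F\<^esub> f') y = f (f' y)"
    if "f \<in> auto F" "f' \<in> auto F" "y \<in> carrier F" for f f' y
    using that by (simp add: AutoGroup_def BijGroup_def auto_def compose_eq)
  have closed: "f \<otimes>\<^bsub>AutoGroup F\<^esub> f' \<in> auto F" if "f \<in> auto F" "f' \<in> auto F" for f f'
    using A.m_closed that by (simp add: carrier)
  have group_hom: "group_hom F F f" if "f \<in> auto F" for f
    using that F by (simp add: auto_def group_hom_def group_hom_axioms_def)
  note hom = group_hom.hom_mult[OF group_hom] group_hom.hom_closed[OF group_hom]
    group_hom.hom_inv[OF group_hom]
  have cancel: "p \<otimes>\<^bsub>F\<^esub> (inv\<^bsub>F\<^esub> p \<otimes>\<^bsub>F\<^esub> q) = q" if "p \<in> carrier F" "q \<in> carrier F" for p q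
    using that by (simp flip: F.m_assoc)
  have eqI: "f = f'"
    if "f \<in> auto F" "f' \<in> auto F" "f x = f' x" "f b = f' b" "f c = f' c"
      "\<And>e. e \<in> E \<Longrightarrow> e \<notin> {x, b, c} \<Longrightarrow> f e = f' e" for f f'
    by (rule auto_eq_on_basis[OF E that(1,2)]) (use that(3-6) in blast)
  note autos = R(1) z(1) s(1) t(1) u(1) v(1)
  have vals: "R x = x \<otimes>\<^bsub>F\<^esub> w" "R b = b" "R c = c" "R w = w"
    "z x = x" "z b = b" "z c = c \<otimes>\<^bsub>F\<^esub> w" "z w = w"
    "s x = x" "s b = b" "s c = c \<otimes>\<^bsub>F\<^esub> b" "s w = w"
    "t x = x" "t b = b \<otimes>\<^bsub>F\<^esub> w" "t c = c" "t w = w"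
    "u x = x" "u b = b" "u c = c \<otimes>\<^bsub>F\<^esub> inv\<^bsub>F\<^esub> x" "u w = w"
    "v x = x \<otimes>\<^bsub>F\<^esub> inv\<^bsub>F\<^esub> c" "v b = b" "v c = c" "v w = w"
    using R(2) z(2) s(2) t(2) u(2) v(2) xbc
    by (simp_all add: RS z(3) s(3) t(3) u(3) v(3) incl wS)
  have other: "f e = e" if "f \<in> {R, z, s, t, u, v}" "e \<in> E" "e \<noteq> x" "e \<noteq> b" "e \<noteq> c" for f e
    using that R(3) z(3) s(3) t(3) u(3) v(3) incl by auto
  have inE: "e \<in> carrier F" if "e \<in> E" for e using sub that by auto
  note calc = mult closed hom autos carr vals other inE cancel F.m_assoc F.inv_mult_group
  have comm: "R \<otimes>\<^bsub>AutoGroup F\<^esub> z = z \<otimes>\<^bsub>AutoGroup F\<^esub> R"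
    "R \<otimes>\<^bsub>AutoGroup F\<^esub> s = s \<otimes>\<^bsub>AutoGroup F\<^esub> R"
    "R \<otimes>\<^bsub>AutoGroup F\<^esub> t = t \<otimes>\<^bsub>AutoGroup F\<^esub> R"
    by (rule eqI; simp add: calc)+
  have commutator: "t \<otimes>\<^bsub>AutoGroup F\<^esub> s = s \<otimes>\<^bsub>AutoGroup F\<^esub> (z \<otimes>\<^bsub>AutoGroup F\<^esub> t)"
    by (rule eqI; simp add: calc)
  have "(R \<otimes>\<^bsub>AutoGroup F\<^esub> z) \<otimes>\<^bsub>AutoGroup F\<^esub> u = u \<otimes>\<^bsub>AutoGroup F\<^esub> R"
    by (rule eqI; simp add: calc)
  then have 1: "A.transl (R \<otimes>\<^bsub>AutoGroup F\<^esub> z) = A.transl R"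
    by (rule A.transl_eq_if_conjugate[rotated 3]) (simp_all add: carrier autos closed)
  have "(R \<otimes>\<^bsub>AutoGroup F\<^esub> z) \<otimes>\<^bsub>AutoGroup F\<^esub> v = v \<otimes>\<^bsub>AutoGroup F\<^esub> z"
    by (rule eqI; simp add: calc)
  then have "A.transl (R \<otimes>\<^bsub>AutoGroup F\<^esub> z) = A.transl z"
    by (rule A.transl_eq_if_conjugate[rotated 3]) (simp_all add: carrier autos closed)
  with 1 show ?thesis
    by (intro A.fixed_point_if_centralizer_commutator[OF _ _ _ _ comm commutator])
      (simp_all add: carrier autos)
qed

section \<open>Words in a free factor of corank two\<close>

theorem proposition3p2:
  fixes F :: "('a, 'm) monoid_scheme"
    and a :: "nat \<Rightarrow> 'a" and n :: nat and w :: 'a and H :: "'a set" and R :: "'a \<Rightarrow> 'a"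
    and X :: "'b set" and d :: "'b \<Rightarrow> 'b \<Rightarrow> real" and \<phi> :: "('a \<Rightarrow> 'a) \<Rightarrow> 'b \<Rightarrow> 'b"
  assumes "n \<ge> 2"
    and "inj_on a {0..n}" and "free_basis F (a ` {0..n})"
    and "free_factor (generated_group F (a ` {1..n})) H"
    and "free_of_rank (F\<lparr>carrier := H\<rparr>) (n - 2)"
    and "w \<in> H"
    and "R \<in> carrier (AutoGroup F)"
    and "R (a 0) = a 0 \<otimes>\<^bsub>F\<^esub> w" and "\<forall>i\<in>{1..n}. R (a i) = a i"
    and "complete_cat0_space X d"
    and "acts_by_semisimple_isometries (AutoGroup F) X d \<phi>"
  shows "\<exists>x\<in>X. \<phi> R x = x"
proof -
  let ?A = "a ` {1..n}" and ?x = "a 0"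
  let ?N = "generated_group F ?A"
  have split: "{0..n} = insert 0 {1..n}" by auto
  have basis: "free_basis F (insert ?x ?A)" using assms(3) unfolding split by simp
  have xA: "?x \<notin> ?A" using assms(2) by (auto dest: inj_onD)
  have F: "group F" and sub: "insert ?x ?A \<subseteq> carrier F" using basis by (auto simp: free_basis_def)
  interpret group F by fact
  have N: "subgroup (generate F ?A) F" using generate_is_subgroup sub by simp
  interpret N: group ?N using subgroup_imp_group[OF N] .
  have basisN: "free_basis ?N ?A" using free_basis_subset[OF basis] by blast
  have "inj_on a {1..n}" using assms(2) by (rule inj_on_subset) auto
  then have cardA: "card ?A = n" by (simp add: card_image)
  obtain B C where B: "free_basis ?N B" and CB: "C \<subseteq> B" and H: "H = generate ?N C"
    using assms(4) unfolding free_factor_def by blast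
  have BN: "B \<subseteq> generate F ?A" using B by (auto simp: free_basis_def)
  have HC: "H = generate F C" unfolding H using generate_consistent[OF _ N, of C] CB BN by auto
  have HN: "H \<subseteq> generate F ?A" unfolding H using N.generate_incl[of C] CB BN by simp
  have subgroup_H: "subgroup H F"
    unfolding HC using CB BN subgroup.subset[OF N] by (intro generate_is_subgroup) auto
  obtain D where D: "free_basis (F\<lparr>carrier := H\<rparr>) D" "finite D" "card D = n - 2"
    using assms(5) unfolding free_of_rank_def by blast
  have DH: "D \<subseteq> H" "generate (F\<lparr>carrier := H\<rparr>) D = H" using D(1) by (auto simp: free_basis_def)
  have "generate ?N D = generate F D" using generate_consistent[OF _ N] DH HN by auto
  also have "\<dots> = H" using generate_consistent[OF DH(1) subgroup_H] DH(2) by simp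
  finally have "generate ?N D = generate ?N C" using H by simp
  moreover have "D \<subseteq> carrier ?N" using DH(1) HN by simp
  moreover have "card D + 2 \<le> card ?A" using D(3) cardA assms(1) by simp
  ultimately obtain b c where bc: "b \<in> B - C" "c \<in> B - C" "b \<noteq> c"
    using two_basis_elements_outside_factor[OF basisN B CB D(2)] by blast
  note ub = universal_basis_insert[OF basis xA B]
  have "C \<subseteq> insert ?x B - {?x, b, c}" using CB bc ub(2) by auto
  then have w: "w \<in> generate F (insert ?x B - {?x, b, c})"
    using mono_generate[of C] assms(6) HC by blast
  have R: "R \<in> auto F" using assms(7) by (simp add: AutoGroup_def)
  have RN: "R y = y" if "y \<in> generate F ?A" for y
  proof (rule hom_eq_on_generate[OF F F _ _ _ _ that])
    show "R \<in> hom F F" "(\<lambda>y. y) \<in> hom F F" using R by (auto simp: auto_def hom_def)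
  qed (use assms(9) sub in auto)
  have act: "semisimple_action (AutoGroup F) X \<phi> d"
    using assms(10,11)
    by (auto simp: semisimple_action_def semisimple_action_axioms_def acts_by_semisimple_isometries_def
        complete_cat0_space_def cat0_space_def)
  show ?thesis
    by (rule transvection_fixed_point[OF ub(1) _ _ _ _ _ bc(3) w R assms(8) _ act])
      (use bc ub(2) RN BN in auto)
qed

end
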